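(* Let $(X,d)$ be a proper Polish metric space, let $p\in[1,\infty)$, let $r>0$, and let $\nu\in\mathcal{P}(X)$ have a finite $p$-th moment. Let $f:X\to\mathbb{R}$ be upper semi-continuous and such that for each $\mu\in\mathcal{B}_r(\nu)$ at least one of the integrals $\int_X[f(x)]_+\,\mathrm{d}\mu(x)$ and $\int_X[-f(x)]_+\,\mathrm{d}\mu(x)$ is finite. If there exist $x_0\in X$, $c>0$ and $p'\in(0,p)$ such that $f(x)\le c\,[1+d^{p'}(x,x_0)]$ for all $x\in X$, then the optimal value of $$\sup\left\{\int_X f(x)\,\mathrm{d}\mu(x):\ \mu\in\mathcal{B}_r(\nu)\right\}$$ is attained, i.e. there exists $\mu^\star\in\mathcal{B}_r(\nu)$ such that $\int_X f\,\mathrm{d}\mu^\star$ equals this supremum.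
   Context: A Polish metric space is a complete and separable metric space. $(X,d)$ is proper if every closed ball $\{x\in X: d(x,x_0)\le R\}$, with $R>0$ and $x_0\in X$, is compact. $\mathcal{P}(X)$ is the set of all Borel probability measures on $X$. For $\mu_1,\mu_2\in\mathcal{P}(X)$, $$W_p(\mu_1,\mu_2)=\inf_{\gamma\in\Gamma(\mu_1,\mu_2)}\left(\int_{X\times X}d^p(x_1,x_2)\,\mathrm{d}\gamma(x_1,x_2)\right)^{1/p}\in[0,\infty],$$ where $\Gamma(\mu_1,\mu_2)$ is the set of probability measures on $X\times X$ with marginals $\mu_1$ and $\mu_2$. The Wasserstein ball is $\mathcal{B}_r(\nu)=\{\mu\in\mathcal{P}(X):W_p(\mu,\nu)\le r\}$. A measure $\mu\in\mathcal{P}(X)$ has a finite $p$-th moment if $\int_X d^p(x,x_0)\,\mathrm{d}\mu(x)<\infty$ for some (equivalently, every) $x_0\in X$. $[t]_+=\max\{t,0\}$. Integrals $\int_X f\,\mathrm{d}\mu=\int_X[f]_+\,\mathrm{d}\mu-\int_X[-f]_+\,\mathrm{d}\mu$ take values in $[-\infty,+\infty]$. *)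

theory Defs
  imports "HOL-Probability.Probability"
begin

definition borel_probs :: "'a::topological_space measure set" where
  "borel_probs = {\<mu>. sets \<mu> = sets borel \<and> prob_space \<mu>}"

(* Since the underlying spaces are second countable, the Borel sets of the product
   are the product sigma-algebra (borel_prod). *)
definition couplings ::
    "'a::second_countable_topology measure \<Rightarrow> 'a measure \<Rightarrow> ('a \<times> 'a) measure set" where
  "couplings \<mu>1 \<mu>2 = {\<gamma> \<in> borel_probs. distr \<gamma> borel fst = \<mu>1 \<and> distr \<gamma> borel snd = \<mu>2}"

(* x to the power a on [0, \<infinity>], intended for a > 0; the library only has powr on reals. *)
definition ennpowr :: "ennreal \<Rightarrow> real \<Rightarrow> ennreal" where
  "ennpowr x a = (if x = \<infinity> then \<infinity> else ennreal (enn2real x powr a))"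

definition wasserstein ::
    "real \<Rightarrow> 'a::{metric_space, second_countable_topology} measure \<Rightarrow> 'a measure \<Rightarrow> ennreal" where
  "wasserstein p \<mu>1 \<mu>2 =
     (INF \<gamma>\<in>couplings \<mu>1 \<mu>2.
        ennpowr (\<integral>\<^sup>+z. ennreal (dist (fst z) (snd z) powr p) \<partial>\<gamma>) (1 / p))"

definition wasserstein_ball ::
    "real \<Rightarrow> real \<Rightarrow> 'a::{metric_space, second_countable_topology} measure \<Rightarrow> 'a measure set" where
  "wasserstein_ball p r \<nu> = {\<mu> \<in> borel_probs. wasserstein p \<mu> \<nu> \<le> ennreal r}"

definition finite_moment :: "real \<Rightarrow> 'a::metric_space measure \<Rightarrow> bool" where
  "finite_moment p \<mu> \<longleftrightarrow> (\<exists>x0. (\<integral>\<^sup>+x. ennreal (dist x x0 powr p) \<partial>\<mu>) < \<infinity>)"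

definition upper_semicontinuous :: "('a::topological_space \<Rightarrow> real) \<Rightarrow> bool" where
  "upper_semicontinuous f \<longleftrightarrow> (\<forall>x0. \<forall>a > f x0. \<forall>\<^sub>F x in nhds x0. f x < a)"

(* Integral with values in [-\<infinity>, \<infinity>]. The library's Bochner integral is 0 for every
   non-integrable function, so it cannot be used here. The value is meaningful only if
   one of the two parts is finite (on ereal, \<infinity> - \<infinity> = \<infinity>). *)
definition ext_integral :: "'a measure \<Rightarrow> ('a \<Rightarrow> real) \<Rightarrow> ereal" where
  "ext_integral \<mu> f =
     enn2ereal (\<integral>\<^sup>+x. ennreal (max (f x) 0) \<partial>\<mu>) - enn2ereal (\<integral>\<^sup>+x. ennreal (max (- f x) 0) \<partial>\<mu>)"

end

theory Submission
  imports Defs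
begin

text \<open>
  The proof is the direct method: the Wasserstein ball is sequentially compact for weak convergence,
  and the objective is upper semicontinuous along the convergent subsequences.

  Weak convergence never appears as such. In its place stands almost sure convergence: a tight
  sequence of laws on a proper space has a subsequence that is realized by random variables
  converging almost surely (\<open>tight_Skorohod_subsequence\<close>). On the real line this is Helly's
  selection theorem followed by Skorohod's theorem. A proper space \<open>Z\<close> is reduced to the line by a
  Borel coding \<open>s\<close> from \<open>Z\<close> to the reals: the integer part of \<open>s z\<close> records the distance of \<open>z\<close> from
  a base point and the digits of its fractional part record to which sets of a countable base \<open>z\<close>
  belongs. Bounded parts of \<open>Z\<close> are compact, so finitely many digits locate \<open>z\<close> up to any given
  precision. Hence \<open>s\<close> reflects Cauchy sequences (\<open>proper_space_real_coding\<close>), its inverse extends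
  continuously to the closure of the range (\<open>continuous_decoding\<close>), and the almost sure limits on
  the line can be decoded.

  With almost sure convergence, everything else is Fatou's lemma for a nonnegative lower
  semicontinuous integrand (\<open>Fatou_lower_semicontinuous\<close>). The representation is applied to nearly
  optimal couplings of \<open>\<mu> n\<close> and \<open>\<nu>\<close> on the product space; they are tight because their costs are
  bounded and \<open>\<nu>\<close> has a finite moment. For indicators of open sets Fatou's lemma shows that the
  second marginal of the limit is still \<open>\<nu>\<close>, for the cost \<open>dist x y powr p\<close> it shows that the limit
  stays in the ball. This is \<open>wasserstein_ball_sequentially_compact\<close>.

  For the objective, let \<open>e > 0\<close>. As \<open>f\<close> grows more slowly than the \<open>p\<close>-th power of the distance, there
  is a constant \<open>K\<close> with \<open>f x \<le> K + e * dist x x0 powr p\<close>. The gap between the two sides is nonnegative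
  and lower semicontinuous, so Fatou's lemma applies to it. The \<open>p\<close>-th moments on the ball have a
  common bound \<open>C\<close>, hence passing from the gap back to \<open>f\<close> costs at most \<open>e * C\<close>, and \<open>e\<close> is
  arbitrary.
\<close>

section \<open>Coding the points of a proper space by real numbers\<close>

text \<open>Base 4 with digits 0 and 1 instead of base 2: the tail after a digit contributes at most a third of
that digit, so there are no ambiguous expansions, and nearby codes have equal leading digits.\<close>
definition digit_code :: "(nat \<Rightarrow> bool) \<Rightarrow> real" where
  "digit_code b = (\<Sum>k. of_bool (b k) / 4 ^ Suc k)"

lemma quarter_powers_sums: "(\<lambda>k. c / 4 ^ Suc k) sums (c / 3 :: real)"
proof -
  have "(\<lambda>k. (1/4 :: real) ^ k) sums (1 / (1 - 1/4))"
    by (intro geometric_sums) auto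
  from sums_mult[OF this, of "c / 4"] show ?thesis
    by (simp add: power_one_over field_simps)
qed

lemma summable_digits: "summable (\<lambda>k. of_bool (b k) / 4 ^ Suc k :: real)"
  by (rule summable_comparison_test[OF _ sums_summable[OF quarter_powers_sums[of 1]]])
     (auto simp: divide_simps)

lemma digit_code_bounds: "0 \<le> digit_code b" "digit_code b \<le> 1/3"
proof -
  show "0 \<le> digit_code b"
    unfolding digit_code_def by (intro suminf_nonneg summable_digits) auto
  have "digit_code b \<le> (\<Sum>k. 1 / 4 ^ Suc k)"
    unfolding digit_code_def
    by (intro suminf_le summable_digits sums_summable[OF quarter_powers_sums[of 1]])
       (auto simp: divide_simps)
  also have "\<dots> = 1/3"
    using sums_unique[OF quarter_powers_sums[of 1]] by simp
  finally show "digit_code b \<le> 1/3" .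
qed

lemma digit_code_split:
  "digit_code b = (\<Sum>j<k. of_bool (b j) / 4 ^ Suc j) + of_bool (b k) / 4 ^ Suc k
     + digit_code (\<lambda>j. b (j + Suc k)) / 4 ^ Suc k"
proof -
  have "digit_code b = (\<Sum>j. of_bool (b (j + Suc k)) / 4 ^ Suc (j + Suc k))
      + (\<Sum>j<Suc k. of_bool (b j) / 4 ^ Suc j)"
    unfolding digit_code_def by (rule suminf_split_initial_segment[OF summable_digits])
  also have "(\<Sum>j. of_bool (b (j + Suc k)) / 4 ^ Suc (j + Suc k) :: real)
      = (\<Sum>j. of_bool (b (j + Suc k)) / 4 ^ Suc j / 4 ^ Suc k)"
    by (simp add: power_add mult.commute mult.left_commute)
  also have "\<dots> = digit_code (\<lambda>j. b (j + Suc k)) / 4 ^ Suc k"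
    unfolding digit_code_def by (rule suminf_divide[OF summable_digits])
  finally show ?thesis by simp
qed

text \<open>At the first digit where the two sequences differ, the digit contributes one unit of that place to
the difference, and the tails can compensate at most a third of it.\<close>
lemma digits_eq_if_codes_close:
  assumes close: "\<bar>digit_code b - digit_code b'\<bar> < 1 / (2 * 4 ^ K)" and "i < K"
  shows "b i = b' i"
proof (rule ccontr)
  assume "b i \<noteq> b' i"
  define k where "k = (LEAST k. b k \<noteq> b' k)"
  have diff: "b k \<noteq> b' k" and "k \<le> i"
    unfolding k_def using \<open>b i \<noteq> b' i\<close>
    by (rule LeastI[of "\<lambda>k. b k \<noteq> b' k"], rule Least_le)
  have same: "b j = b' j" if "j < k" for j
    using not_less_Least[of j "\<lambda>k. b k \<noteq> b' k"] that by (auto simp: k_def)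
  define u where "u = of_bool (b k) + digit_code (\<lambda>j. b (j + Suc k))"
  define u' where "u' = of_bool (b' k) + digit_code (\<lambda>j. b' (j + Suc k))"
  have "digit_code b - digit_code b' = (u - u') / 4 ^ Suc k"
    unfolding digit_code_split[of b k] digit_code_split[of b' k] u_def u'_def
    using same by (simp add: diff_divide_distrib add_divide_distrib)
  moreover have "2/3 \<le> \<bar>u - u'\<bar>"
    unfolding u_def u'_def
    using diff digit_code_bounds[of "\<lambda>j. b (j + Suc k)"] digit_code_bounds[of "\<lambda>j. b' (j + Suc k)"]
    by (cases "b k"; cases "b' k") auto
  ultimately have "(2/3) / 4 ^ Suc k \<le> \<bar>digit_code b - digit_code b'\<bar>"
    by (simp only: abs_divide power_abs abs_numeral) (intro divide_right_mono, auto)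
  moreover have "1 / (2 * 4 ^ K) \<le> (2/3) / (4 ^ Suc k :: real)"
  proof -
    have "(4::real) ^ Suc k \<le> 4 ^ K"
      using \<open>i < K\<close> \<open>k \<le> i\<close> by (intro power_increasing) auto
    then have "3 * (4::real) ^ k \<le> 4 ^ K"
      using zero_le_power[of "4::real" k] unfolding power_Suc by linarith
    then show ?thesis
      by (simp add: divide_simps)
  qed
  ultimately show False using close by linarith
qed

text \<open>The function \<open>s\<close> is the integer part of the distance to \<open>z0\<close> plus the digit code of the membership of
\<open>z\<close> in the sets of a countable base. The integer part keeps points with bounded codes in a common
compact ball; this ball is covered by finitely many small base sets, and once enough digits of two
codes agree, both points lie in the same small set.\<close>
lemma proper_space_real_coding:
  fixes z0 :: "'z::{metric_space, second_countable_topology}"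
  assumes proper: "\<And>R. compact (cball z0 R)"
  obtains s :: "'z \<Rightarrow> real"
  where "s \<in> borel_measurable borel"
    and "\<And>z. \<bar>s z - dist z z0\<bar> \<le> 1"
    and "\<And>X. Cauchy (\<lambda>n. s (X n)) \<Longrightarrow> Cauchy X"
proof -
  obtain B :: "'z set set" where "countable B" and B: "topological_basis B"
    using ex_countable_basis by blast
  have "B \<noteq> {}"
    using topological_basisE[OF B open_UNIV UNIV_I] by blast
  define A where "A = from_nat_into B"
  have rangeA: "range A = B"
    unfolding A_def by (rule range_from_nat_into) fact+
  have openA: "open (A k)" for k
    using rangeA B topological_basis_open by blast
  define c where "c z = digit_code (\<lambda>k. z \<in> A k)" for z
  define s where "s z = real_of_int \<lfloor>dist z z0\<rfloor> + c z" for z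
  have c_bounds: "0 \<le> c z" "c z \<le> 1/3" for z
    unfolding c_def by (rule digit_code_bounds)+
  have s_near: "\<bar>s z - dist z z0\<bar> \<le> 1" for z
    unfolding s_def using c_bounds[of z] by linarith
  have [measurable]: "A k \<in> sets borel" for k
    using openA by auto
  have "s \<in> borel_measurable borel"
    unfolding s_def c_def digit_code_def of_bool_def by measurable
  moreover have "Cauchy X" if Cs: "Cauchy (\<lambda>n. s (X n))" for X
  proof -
    obtain R where R: "\<And>n. \<bar>s (X n)\<bar> \<le> R"
      using Cauchy_Bseq[OF Cs] unfolding Bseq_def by auto
    let ?C = "cball z0 (R + 1)"
    have inC: "X n \<in> ?C" for n
      using R[of n] s_near[of "X n"] by (auto simp: dist_commute)
    show "Cauchy X"
      unfolding Cauchy_altdef2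
    proof (intro allI impI)
      fix e :: real assume "0 < e"
      have "\<exists>k. z \<in> A k \<and> A k \<subseteq> ball z (e/2)" for z
        using topological_basisE[OF B open_ball[of z "e/2"]] \<open>0 < e\<close> rangeA
        by (metis centre_in_ball half_gt_zero rangeE)
      then obtain \<kappa> where \<kappa>: "\<And>z. z \<in> A (\<kappa> z)" "\<And>z. A (\<kappa> z) \<subseteq> ball z (e/2)"
        by metis
      have "?C \<subseteq> (\<Union>z\<in>?C. A (\<kappa> z))"
        using \<kappa>(1) by auto
      then obtain D where D: "finite D" "?C \<subseteq> (\<Union>z\<in>D. A (\<kappa> z))"
        using compactE_image[OF proper[of "R + 1"] openA] by metis
      obtain K where K: "\<And>z. z \<in> D \<Longrightarrow> \<kappa> z < K"
        using finite_nat_bounded[of "\<kappa> ` D"] D(1) by auto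
      define \<delta> :: real where "\<delta> = 1 / (2 * 4 ^ K)"
      have \<delta>: "0 < \<delta>" "\<delta> \<le> 1/2"
        unfolding \<delta>_def by (auto simp: divide_simps)
      obtain N where N: "\<And>n. n \<ge> N \<Longrightarrow> dist (s (X n)) (s (X N)) < \<delta>"
        using Cs \<delta>(1) unfolding Cauchy_altdef2 by blast
      have "dist (X n) (X N) < e" if "n \<ge> N" for n
      proof -
        have d: "\<bar>s (X n) - s (X N)\<bar> < \<delta>"
          using N[OF that] by (simp add: dist_real_def)
        have "\<lfloor>dist (X n) z0\<rfloor> = \<lfloor>dist (X N) z0\<rfloor>"
          using d \<delta>(2) c_bounds[of "X n"] c_bounds[of "X N"] unfolding s_def by linarith
        then have "\<bar>c (X n) - c (X N)\<bar> < \<delta>"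
          using d unfolding s_def by simp
        then have eq: "X n \<in> A k \<longleftrightarrow> X N \<in> A k" if "k < K" for k
          using digits_eq_if_codes_close that unfolding c_def \<delta>_def by blast
        obtain z where "z \<in> D" "X N \<in> A (\<kappa> z)"
          using D(2) inC by blast
        then have "X n \<in> ball z (e/2)" "X N \<in> ball z (e/2)"
          using eq K \<kappa>(2) by blast+
        then show ?thesis
          using dist_triangle_half_r[of z "X n" e "X N"] by simp
      qed
      then show "\<exists>N. \<forall>n\<ge>N. dist (X n) (X N) < e" by blast
    qed
  qed
  ultimately show thesis
    using that s_near by blast
qed

text \<open>A map that reflects Cauchy sequences is injective (apply it to a sequence alternating between two
points with the same image), and its inverse maps Cauchy sequences to Cauchy sequences; such a map into
a complete space extends continuously to the closure of its domain.\<close>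
lemma continuous_decoding:
  fixes s :: "'z::complete_space \<Rightarrow> 'y::metric_space"
  assumes Cauchy_lift: "\<And>X. Cauchy (\<lambda>n. s (X n)) \<Longrightarrow> Cauchy X"
  obtains \<pi> where "continuous_on (closure (range s)) \<pi>" and "\<And>z. \<pi> (s z) = z"
proof -
  have "inj s"
  proof (rule injI)
    fix z w assume eq: "s z = s w"
    define X where "X n = (if even n then z else w)" for n :: nat
    have "(\<lambda>n. s (X n)) = (\<lambda>n. s z)"
      using eq by (auto simp: X_def)
    then have "Cauchy (\<lambda>n. s (X n))"
      by (simp add: convergent_Cauchy convergent_const)
    then have "Cauchy X" by (rule Cauchy_lift)
    show "z = w"
    proof (rule ccontr)
      assume "z \<noteq> w"
      then obtain N where N: "\<And>m n. m \<ge> N \<Longrightarrow> n \<ge> N \<Longrightarrow> dist (X m) (X n) < dist z w"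
        using \<open>Cauchy X\<close> unfolding Cauchy_def by (metis zero_less_dist_iff)
      show False
        using N[of "2 * N" "2 * N + 1"] by (simp add: X_def)
    qed
  qed
  have "Cauchy_continuous_on (range s) (inv s)"
    unfolding Cauchy_continuous_on_def
  proof (intro allI impI)
    fix Y :: "nat \<Rightarrow> 'y" assume "Cauchy Y" and "range Y \<subseteq> range s"
    then have "Y = (\<lambda>n. s ((inv s \<circ> Y) n))"
      by (auto simp: fun_eq_iff f_inv_into_f image_subset_iff)
    then show "Cauchy (inv s \<circ> Y)"
      using \<open>Cauchy Y\<close> Cauchy_lift by metis
  qed
  then have "Cauchy_continuous_map (submetric euclidean_metric (range s)) euclidean_metric (inv s)"
    by simp
  moreover have "mcomplete_of (euclidean_metric :: 'z metric)"
    by (simp add: mcomplete_of_def complete_UNIV)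
  ultimately obtain \<pi> where
    "continuous_map (subtopology (mtopology_of euclidean_metric)
        (mtopology_of euclidean_metric closure_of range s)) (mtopology_of euclidean_metric) \<pi>"
    and "\<And>y. y \<in> range s \<Longrightarrow> \<pi> y = inv s y"
    using Cauchy_continuous_map_extends_to_continuous_closure_of by blast
  then show thesis
    using that[of \<pi>] \<open>inj s\<close> by simp
qed

section \<open>Almost sure representation of tight sequences\<close>

text \<open>The coded laws on the real line are tight, so Helly's and Skorohod's theorems provide almost
surely convergent codes, and these are decoded. The decoded variables have the right laws since
decoding is a left inverse of the coding, and they converge since almost surely all codes, and
hence their limit, lie in the closure on which decoding is continuous.\<close>
lemma tight_Skorohod_subsequence:
  fixes \<gamma> :: "nat \<Rightarrow> 'z::{complete_space, second_countable_topology} measure" and z0 :: 'z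
  assumes proper: "\<And>R. compact (cball z0 R)"
    and \<gamma>: "\<And>n. \<gamma> n \<in> borel_probs"
    and tight: "\<And>e. 0 < e \<Longrightarrow> \<exists>R. \<forall>n. measure (\<gamma> n) {z. R < dist z z0} \<le> e"
  obtains k :: "nat \<Rightarrow> nat" and \<Omega> :: "real measure" and Z :: "nat \<Rightarrow> real \<Rightarrow> 'z" and Z' :: "real \<Rightarrow> 'z"
  where "strict_mono k" and "prob_space \<Omega>"
    and "\<And>n. Z n \<in> borel_measurable \<Omega>" and "Z' \<in> borel_measurable \<Omega>"
    and "\<And>n. distr \<Omega> borel (Z n) = \<gamma> (k n)"
    and "AE \<omega> in \<Omega>. (\<lambda>n. Z n \<omega>) \<longlonglongrightarrow> Z' \<omega>"
proof -
  obtain s :: "'z \<Rightarrow> real" where s[measurable]: "s \<in> borel_measurable borel"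
    and s_near: "\<And>z. \<bar>s z - dist z z0\<bar> \<le> 1"
    and s_Cauchy: "\<And>X. Cauchy (\<lambda>n. s (X n)) \<Longrightarrow> Cauchy X"
    using proper_space_real_coding[OF proper] by blast
  obtain \<pi> where \<pi>: "continuous_on (closure (range s)) \<pi>" "\<And>z. \<pi> (s z) = z"
    using continuous_decoding[OF s_Cauchy] by blast
  define F where "F = closure (range s)"
  have closedF: "closed F" and inF: "s z \<in> F" for z
    unfolding F_def by (auto intro: subsetD[OF closure_subset])
  have [measurable]: "F \<in> sets borel"
    using closedF by simp
  \<comment> \<open>The value outside the closed set \<open>F\<close> only serves to make a Borel function on the whole line.\<close>
  define decode where "decode y = (if y \<in> F then \<pi> y else z0)" for y
  have decode_meas[measurable]: "decode \<in> borel_measurable borel"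
    unfolding decode_def using \<pi>(1) closedF
    by (intro borel_measurable_continuous_on_if) (auto simp: F_def)
  have decode_s: "decode (s z) = z" for z
    using \<pi>(2) inF by (simp add: decode_def)

  have sets\<gamma>[measurable_cong]: "sets (\<gamma> n) = sets borel" and prob\<gamma>: "prob_space (\<gamma> n)" for n
    using \<gamma> by (auto simp: borel_probs_def)
  have space\<gamma>[simp]: "space (\<gamma> n) = UNIV" for n
    using sets_eq_imp_space_eq[OF sets\<gamma>] by simp
  define m where "m n = distr (\<gamma> n) borel s" for n
  have rd: "real_distribution (m n)" for n
    unfolding m_def using prob_space.prob_space_distr[OF prob\<gamma>, of s n borel]
    by (auto simp: real_distribution_def real_distribution_axioms_def)
  have "tight m"
    unfolding tight_def
  proof (intro conjI allI impI rd)
    fix e :: real assume "0 < e"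
    then obtain R0 where R0: "\<And>n. measure (\<gamma> n) {z. R0 < dist z z0} \<le> e / 2"
      using tight[of "e/2"] by auto
    define R where "R = max R0 0"
    \<comment> \<open>Codes deviate from the distance to \<open>z0\<close> by at most 1 and are therefore never below -1.\<close>
    have "1 - e < measure (m n) {- 2<..R + 1}" for n
    proof -
      interpret prob_space "\<gamma> n" by (rule prob\<gamma>)
      have [measurable]: "{z. R0 < dist z z0} \<in> sets borel"
        by measurable
      have "1 - e < 1 - measure (\<gamma> n) {z. R0 < dist z z0}"
        using R0[of n] \<open>0 < e\<close> by linarith
      also have "\<dots> = measure (\<gamma> n) (space (\<gamma> n) - {z. R0 < dist z z0})"
        by (subst prob_compl) auto
      also have "\<dots> \<le> measure (\<gamma> n) (s -` {- 2<..R + 1} \<inter> space (\<gamma> n))"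
      proof (rule finite_measure_mono)
        show "space (\<gamma> n) - {z. R0 < dist z z0} \<subseteq> s -` {- 2<..R + 1} \<inter> space (\<gamma> n)"
        proof
          fix z assume "z \<in> space (\<gamma> n) - {z. R0 < dist z z0}"
          then have "dist z z0 \<le> R0" by simp
          then have "- 2 < s z" "s z \<le> R + 1"
            using s_near[of z] zero_le_dist[of z z0] unfolding R_def by linarith+
          then show "z \<in> s -` {- 2<..R + 1} \<inter> space (\<gamma> n)"
            by simp
        qed
      qed measurable
      also have "\<dots> = measure (m n) {- 2<..R + 1}"
        unfolding m_def by (subst measure_distr) auto
      finally show ?thesis .
    qed
    moreover have "- 2 < R + 1"
      by (simp add: R_def)
    ultimately show "\<exists>a b. a < b \<and> (\<forall>n. 1 - e < measure (m n) {a<..b})" by blast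
  qed
  then obtain k M where k: "strict_mono k" and M: "real_distribution M"
    and "weak_conv_m (m \<circ> id \<circ> k) M"
    using tight_imp_convergent_subsubsequence[of m id] strict_mono_id by blast
  then have weak: "weak_conv_m (\<lambda>n. m (k n)) M"
    by (simp add: comp_def)
  obtain \<Omega> :: "real measure" and Y Y' where \<Omega>: "prob_space \<Omega>"
    and Y[measurable]: "\<And>n. Y n \<in> borel_measurable \<Omega>" and dY: "\<And>n. distr \<Omega> borel (Y n) = m (k n)"
    and Y'[measurable]: "Y' \<in> borel_measurable \<Omega>"
    and lim: "\<And>\<omega>. \<omega> \<in> space \<Omega> \<Longrightarrow> (\<lambda>n. Y n \<omega>) \<longlonglongrightarrow> Y' \<omega>"
    using Skorohod[OF rd M weak] by force
  have "AE y in m (k n). y \<in> F" for n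
    unfolding m_def using inF by (subst AE_distr_iff) auto
  then have "AE \<omega> in \<Omega>. Y n \<omega> \<in> F" for n
    unfolding dY[symmetric] by (subst (asm) AE_distr_iff) auto
  then have "AE \<omega> in \<Omega>. \<forall>n. Y n \<omega> \<in> F"
    by (simp add: AE_all_countable)
  then have conv: "AE \<omega> in \<Omega>. (\<lambda>n. decode (Y n \<omega>)) \<longlonglongrightarrow> decode (Y' \<omega>)"
  proof (rule AE_mp, intro AE_I2 impI)
    fix \<omega> assume \<omega>: "\<omega> \<in> space \<Omega>" and YF: "\<forall>n. Y n \<omega> \<in> F"
    then have "Y' \<omega> \<in> F"
      using closed_sequentially[OF closedF _ lim[OF \<omega>]] by blast
    then have "(\<lambda>n. \<pi> (Y n \<omega>)) \<longlonglongrightarrow> \<pi> (Y' \<omega>)"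
      using continuous_on_tendsto_compose[OF \<pi>(1) lim[OF \<omega>]] YF by (simp add: F_def)
    then show "(\<lambda>n. decode (Y n \<omega>)) \<longlonglongrightarrow> decode (Y' \<omega>)"
      using YF \<open>Y' \<omega> \<in> F\<close> by (simp add: decode_def)
  qed
  have "distr \<Omega> borel (\<lambda>\<omega>. decode (Y n \<omega>)) = \<gamma> (k n)" for n
  proof -
    have "distr \<Omega> borel (\<lambda>\<omega>. decode (Y n \<omega>)) = distr (m (k n)) borel decode"
      unfolding dY[symmetric] by (subst distr_distr) (auto simp: comp_def)
    also have "\<dots> = distr (\<gamma> (k n)) borel (\<lambda>z. decode (s z))"
      unfolding m_def by (subst distr_distr) (auto simp: comp_def)
    also have "\<dots> = \<gamma> (k n)"
      unfolding decode_s by (rule distr_id2) (simp add: sets\<gamma>)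
    finally show ?thesis .
  qed
  then show thesis
    using that[of k \<Omega> "\<lambda>n \<omega>. decode (Y n \<omega>)" "\<lambda>\<omega>. decode (Y' \<omega>)"] k \<Omega> conv by simp
qed

section \<open>Power inequalities\<close>

text \<open>Beyond the threshold \<open>T\<close> with \<open>e * T powr (p - p') = 1\<close> the higher power dominates; below it, the
lower power is at most \<open>T powr p'\<close>.\<close>
lemma powr_le_const_plus_eps_powr:
  fixes p p' e :: real
  assumes "0 < p'" "p' < p" "0 < e"
  obtains K where "0 \<le> K" and "\<And>t. 0 \<le> t \<Longrightarrow> t powr p' \<le> K + e * t powr p"
proof -
  define T where "T = (1 / e) powr (1 / (p - p'))"
  have "0 < T"
    using \<open>0 < e\<close> by (simp add: T_def)
  have "t powr p' \<le> T powr p' + e * t powr p" if "0 \<le> t" for t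
  proof (cases "t \<le> T")
    case True
    then have "t powr p' \<le> T powr p'"
      using assms that by (intro powr_mono2) auto
    moreover have "0 \<le> e * t powr p"
      using assms by simp
    ultimately show ?thesis by linarith
  next
    case False
    have "1 / e = T powr (p - p')"
      using assms by (simp add: T_def powr_powr)
    also have "\<dots> \<le> t powr (p - p')"
      using False assms \<open>0 < T\<close> by (intro powr_mono2) auto
    finally have "1 \<le> e * t powr (p - p')"
      using assms by (simp add: field_simps)
    then have "t powr p' * 1 \<le> t powr p' * (e * t powr (p - p'))"
      by (intro mult_left_mono) auto
    also have "\<dots> = e * t powr p"
      using False \<open>0 < T\<close> by (simp add: powr_add[symmetric] mult.left_commute)
    finally show ?thesis
      using powr_ge_zero[of T p'] by linarith
  qed
  then show thesis
    using that[of "T powr p'"] by simp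
qed

lemma powr_add_le:
  fixes a b p :: real
  assumes "0 \<le> a" "0 \<le> b" "0 \<le> p"
  shows "(a + b) powr p \<le> 2 powr p * (a powr p + b powr p)"
proof -
  have "(a + b) powr p \<le> (2 * max a b) powr p"
    using assms by (intro powr_mono2) auto
  also have "\<dots> = 2 powr p * max a b powr p"
    using assms by (simp add: powr_mult)
  also have "\<dots> \<le> 2 powr p * (a powr p + b powr p)"
    by (intro mult_left_mono) (auto simp: max_def)
  finally show ?thesis .
qed

lemma le_one_plus_powr:
  fixes t p :: real
  assumes "0 \<le> t" "1 \<le> p"
  shows "t \<le> 1 + t powr p"
proof (cases "t \<le> 1")
  case True
  then show ?thesis using powr_ge_zero[of t p] by linarith
next
  case False
  then have "t powr 1 \<le> t powr p"
    using assms by (intro powr_mono) auto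
  then show ?thesis using False by simp
qed

section \<open>Fatou's lemma and limits of laws\<close>

lemma upper_semicontinuous_borel_measurable:
  assumes "upper_semicontinuous f"
  shows "f \<in> borel_measurable borel"
proof (subst borel_measurable_iff_less, intro allI)
  fix a
  have "open {x. f x < a}"
  proof (subst open_subopen, intro ballI)
    fix x assume "x \<in> {x. f x < a}"
    then have "\<forall>\<^sub>F y in nhds x. f y < a"
      using assms by (simp add: upper_semicontinuous_def)
    then show "\<exists>T. open T \<and> x \<in> T \<and> T \<subseteq> {x. f x < a}"
      unfolding eventually_nhds by auto
  qed
  then show "{w \<in> space borel. f w < a} \<in> sets borel" by simp
qed

lemma borel_probsD:
  assumes "\<mu> \<in> borel_probs"
  shows "sets \<mu> = sets borel" and "space \<mu> = UNIV" and "prob_space \<mu>" and "emeasure \<mu> UNIV = 1"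
proof -
  show *: "sets \<mu> = sets borel" "prob_space \<mu>"
    using assms by (auto simp: borel_probs_def)
  show "space \<mu> = UNIV"
    using sets_eq_imp_space_eq[OF *(1)] by simp
  then show "emeasure \<mu> UNIV = 1"
    using prob_space.emeasure_space_1[OF *(2)] by simp
qed

lemma borel_probs_distr:
  assumes "prob_space M" "X \<in> borel_measurable M"
  shows "distr M borel X \<in> borel_probs"
  using prob_space.prob_space_distr[OF assms] by (simp add: borel_probs_def)

text \<open>The sequential form of lower semicontinuity is exactly what Fatou's lemma needs pointwise.\<close>
definition seq_lower_semicontinuous :: "('z::topological_space \<Rightarrow> ennreal) \<Rightarrow> bool" where
  "seq_lower_semicontinuous h \<longleftrightarrow> (\<forall>X z. X \<longlonglongrightarrow> z \<longrightarrow> h z \<le> liminf (\<lambda>n. h (X n)))"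

lemma Fatou_lower_semicontinuous:
  fixes h :: "'z::topological_space \<Rightarrow> ennreal"
  assumes [measurable]: "h \<in> borel_measurable borel"
    and lsc: "seq_lower_semicontinuous h"
    and [measurable]: "\<And>n. Z n \<in> borel_measurable \<Omega>" "Z' \<in> borel_measurable \<Omega>"
    and lim: "AE \<omega> in \<Omega>. (\<lambda>n. Z n \<omega>) \<longlonglongrightarrow> Z' \<omega>"
  shows "(\<integral>\<^sup>+z. h z \<partial>distr \<Omega> borel Z') \<le> liminf (\<lambda>n. \<integral>\<^sup>+z. h z \<partial>distr \<Omega> borel (Z n))"
proof -
  have "(\<integral>\<^sup>+z. h z \<partial>distr \<Omega> borel Z') = (\<integral>\<^sup>+\<omega>. h (Z' \<omega>) \<partial>\<Omega>)"
    by (rule nn_integral_distr) measurable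
  also have "\<dots> \<le> (\<integral>\<^sup>+\<omega>. liminf (\<lambda>n. h (Z n \<omega>)) \<partial>\<Omega>)"
    using lim lsc unfolding seq_lower_semicontinuous_def
    by (intro nn_integral_mono_AE) (auto elim!: eventually_mono)
  also have "\<dots> \<le> liminf (\<lambda>n. \<integral>\<^sup>+\<omega>. h (Z n \<omega>) \<partial>\<Omega>)"
    by (rule nn_integral_liminf) measurable
  also have "\<dots> = liminf (\<lambda>n. \<integral>\<^sup>+z. h z \<partial>distr \<Omega> borel (Z n))"
    by (subst nn_integral_distr) auto
  finally show ?thesis .
qed

text \<open>By outer regularity the inequality passes from open sets to all Borel sets; applied to complements
it becomes an equality because both measures have total mass one.\<close>
lemma prob_eq_if_le_on_open:
  fixes \<mu> \<nu> :: "'a::{second_countable_topology, complete_space} measure"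
  assumes \<mu>: "\<mu> \<in> borel_probs" and \<nu>: "\<nu> \<in> borel_probs"
    and le: "\<And>U. open U \<Longrightarrow> emeasure \<mu> U \<le> emeasure \<nu> U"
  shows "\<mu> = \<nu>"
proof (rule measure_eqI)
  note M = borel_probsD[OF \<mu>] and N = borel_probsD[OF \<nu>]
  show "sets \<mu> = sets \<nu>" using M N by simp
  have le_borel: "emeasure \<mu> B \<le> emeasure \<nu> B" if B: "B \<in> sets borel" for B
  proof -
    have "emeasure \<mu> B \<le> emeasure \<nu> U" if "B \<subseteq> U" "open U" for U
      using emeasure_mono[of B U \<mu>] le[OF that(2)] that M(1) by (auto intro: order_trans)
    then show ?thesis
      using N B by (subst outer_regular[of \<nu> B]) (auto intro!: INF_greatest)
  qed
  fix A assume "A \<in> sets \<mu>"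
  then have A: "A \<in> sets borel" using M by simp
  then have A': "- A \<in> sets borel" by (rule borel_comp)
  interpret \<mu>: prob_space \<mu> by (rule M)
  interpret \<nu>: prob_space \<nu> by (rule N)
  have "measure \<mu> A \<le> measure \<nu> A" "measure \<mu> (- A) \<le> measure \<nu> (- A)"
    using le_borel[OF A] le_borel[OF A'] by (simp_all add: \<mu>.emeasure_eq_measure \<nu>.emeasure_eq_measure)
  moreover have "measure \<mu> (- A) = 1 - measure \<mu> A" "measure \<nu> (- A) = 1 - measure \<nu> A"
    using \<mu>.prob_compl[of A] \<nu>.prob_compl[of A] A M N by (simp_all add: Compl_eq_Diff_UNIV)
  ultimately show "emeasure \<mu> A = emeasure \<nu> A"
    by (simp add: \<mu>.emeasure_eq_measure \<nu>.emeasure_eq_measure)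
qed

lemma liminf_le_bound:
  fixes u :: "nat \<Rightarrow> ennreal"
  assumes "\<forall>\<^sub>F n in sequentially. u n \<le> b"
  shows "liminf u \<le> b"
  using Liminf_mono[OF assms] by (simp add: Liminf_const)

text \<open>The indicator of an open set is lower semicontinuous, so Fatou's lemma bounds the limit law by the
common law on open sets.\<close>
lemma law_of_limit_eq_common_law:
  fixes Z' :: "'w \<Rightarrow> 'z::{second_countable_topology, complete_space}"
  assumes \<Omega>: "prob_space \<Omega>"
    and [measurable]: "\<And>n. Z n \<in> borel_measurable \<Omega>" "Z' \<in> borel_measurable \<Omega>"
    and lim: "AE \<omega> in \<Omega>. (\<lambda>n. Z n \<omega>) \<longlonglongrightarrow> Z' \<omega>"
    and law: "\<And>n. distr \<Omega> borel (Z n) = \<nu>"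
  shows "distr \<Omega> borel Z' = \<nu>"
proof (rule prob_eq_if_le_on_open)
  show "distr \<Omega> borel Z' \<in> borel_probs" "\<nu> \<in> borel_probs"
    using borel_probs_distr[OF \<Omega>, of Z'] borel_probs_distr[OF \<Omega>, of "Z 0"] law by auto
  fix U :: "'z set" assume "open U"
  then have [measurable]: "U \<in> sets borel" by simp
  have "indicator U z \<le> liminf (\<lambda>n. indicator U (X n) :: ennreal)" if "X \<longlonglongrightarrow> z" for X z
  proof (cases "z \<in> U")
    case True
    have "\<forall>\<^sub>F n in sequentially. (1::ennreal) \<le> indicator U (X n)"
      using topological_tendstoD[OF that \<open>open U\<close> True] by eventually_elim simp
    then have "1 \<le> liminf (\<lambda>n. indicator U (X n) :: ennreal)"
      by (rule Liminf_bounded)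
    then show ?thesis using True by simp
  qed simp
  then have "seq_lower_semicontinuous (indicator U)"
    unfolding seq_lower_semicontinuous_def by blast
  then have "(\<integral>\<^sup>+z. indicator U z \<partial>distr \<Omega> borel Z')
      \<le> liminf (\<lambda>n. \<integral>\<^sup>+z. indicator U z \<partial>distr \<Omega> borel (Z n))"
    using lim by (intro Fatou_lower_semicontinuous) auto
  moreover have "sets \<nu> = sets borel"
    using law[of 0] by auto
  ultimately show "emeasure (distr \<Omega> borel Z') U \<le> emeasure \<nu> U"
    unfolding law by (simp add: Liminf_const)
qed

section \<open>Couplings with bounded cost\<close>

lemma borel_measurable_fst_snd [measurable]:
  "fst \<in> borel_measurable (borel :: ('a::topological_space \<times> 'b::topological_space) measure)"
  "snd \<in> borel_measurable (borel :: ('a \<times> 'b) measure)"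
  by (auto intro!: borel_measurable_continuous_onI continuous_intros)

lemma couplingsD:
  assumes "\<gamma> \<in> couplings \<mu> \<nu>"
  shows "\<gamma> \<in> borel_probs" "distr \<gamma> borel fst = \<mu>" "distr \<gamma> borel snd = \<nu>"
  using assms by (auto simp: couplings_def)

lemma wasserstein_less_obtains:
  assumes "0 < p" "wasserstein p \<mu> \<nu> < ennreal R"
  obtains \<gamma> where "\<gamma> \<in> couplings \<mu> \<nu>"
    and "(\<integral>\<^sup>+z. ennreal (dist (fst z) (snd z) powr p) \<partial>\<gamma>) \<le> ennreal (R powr p)"
proof -
  obtain \<gamma> where \<gamma>: "\<gamma> \<in> couplings \<mu> \<nu>"
    and less: "ennpowr (\<integral>\<^sup>+z. ennreal (dist (fst z) (snd z) powr p) \<partial>\<gamma>) (1 / p) < ennreal R"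
    using assms(2) unfolding wasserstein_def INF_less_iff by blast
  let ?I = "\<integral>\<^sup>+z. ennreal (dist (fst z) (snd z) powr p) \<partial>\<gamma>"
  have "?I \<noteq> \<infinity>"
    using less by (auto simp: ennpowr_def)
  then obtain t where t: "?I = ennreal t" "0 \<le> t"
    by (cases ?I) auto
  then have "t powr (1 / p) < R"
    using less by (simp add: ennpowr_def ennreal_less_iff)
  then have "(t powr (1 / p)) powr p \<le> R powr p"
    using \<open>0 < p\<close> by (intro powr_mono2) auto
  then have "t \<le> R powr p"
    using t \<open>0 < p\<close> by (simp add: powr_powr)
  then show thesis
    using that[OF \<gamma>] t by (simp add: ennreal_leI)
qed

lemma wasserstein_leI:
  assumes "\<gamma> \<in> couplings \<mu> \<nu>" "0 < p" "0 \<le> R"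
    and le: "(\<integral>\<^sup>+z. ennreal (dist (fst z) (snd z) powr p) \<partial>\<gamma>) \<le> ennreal (R powr p)"
  shows "wasserstein p \<mu> \<nu> \<le> ennreal R"
proof -
  let ?I = "\<integral>\<^sup>+z. ennreal (dist (fst z) (snd z) powr p) \<partial>\<gamma>"
  obtain t where t: "?I = ennreal t" "0 \<le> t"
    using le by (cases ?I) (auto simp: top_unique)
  then have "t \<le> R powr p"
    using le by simp
  then have "t powr (1 / p) \<le> (R powr p) powr (1 / p)"
    using t \<open>0 < p\<close> by (intro powr_mono2) auto
  then have "ennpowr ?I (1 / p) \<le> ennreal R"
    using t \<open>0 < p\<close> \<open>0 \<le> R\<close> by (simp add: ennpowr_def powr_powr ennreal_leI)
  then show ?thesis
    unfolding wasserstein_def using assms(1) by (intro INF_lower2)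
qed

text \<open>The diagonal coupling has cost zero.\<close>
lemma wasserstein_ball_center:
  assumes \<nu>: "\<nu> \<in> borel_probs" and "0 < p" "0 \<le> r"
  shows "\<nu> \<in> wasserstein_ball p r \<nu>"
proof -
  note N = borel_probsD[OF \<nu>]
  let ?\<gamma> = "distr \<nu> borel (\<lambda>x. (x, x))"
  have [measurable_cong]: "sets \<nu> = sets borel" by (rule N)
  have "distr \<nu> borel (\<lambda>x. x) = \<nu>"
    by (rule distr_id2) (simp add: N)
  moreover have diag [measurable]: "(\<lambda>x. (x, x)) \<in> borel_measurable \<nu>"
    by measurable
  ultimately have "?\<gamma> \<in> couplings \<nu> \<nu>"
    using borel_probs_distr[OF N(3) diag] unfolding couplings_def
    by (simp add: distr_distr[OF _ diag] borel_measurable_fst_snd comp_def)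
  moreover have "(\<integral>\<^sup>+z. ennreal (dist (fst z) (snd z) powr p) \<partial>?\<gamma>) = 0"
    by (subst nn_integral_distr) auto
  ultimately show ?thesis
    using assms wasserstein_leI[of ?\<gamma> \<nu> \<nu> p r] by (simp add: wasserstein_ball_def)
qed

section \<open>Sequential compactness of the Wasserstein ball\<close>

text \<open>This is Markov's inequality.\<close>
lemma bounded_mean_distance_imp_tight:
  fixes \<gamma> :: "nat \<Rightarrow> 'z::{metric_space, second_countable_topology} measure"
  assumes \<gamma>: "\<And>n. \<gamma> n \<in> borel_probs"
    and bound: "\<And>n. (\<integral>\<^sup>+z. ennreal (dist z z0) \<partial>\<gamma> n) \<le> ennreal C" and "0 \<le> C" "0 < e"
  shows "\<exists>R. \<forall>n. measure (\<gamma> n) {z. R < dist z z0} \<le> e"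
proof (intro exI allI)
  fix n
  define R where "R = (C + 1) / e"
  have "0 < R"
    using assms by (simp add: R_def)
  note G = borel_probsD[OF \<gamma>[of n]]
  interpret prob_space "\<gamma> n" by (rule G)
  have [measurable_cong]: "sets (\<gamma> n) = sets borel" by (rule G)
  have [measurable]: "{z. R < dist z z0} \<in> sets borel"
    by measurable
  have "ennreal R * emeasure (\<gamma> n) {z. R < dist z z0}
      = (\<integral>\<^sup>+z. ennreal R * indicator {z. R < dist z z0} z \<partial>\<gamma> n)"
    by (subst nn_integral_cmult_indicator) auto
  also have "\<dots> \<le> (\<integral>\<^sup>+z. ennreal (dist z z0) \<partial>\<gamma> n)"
    using \<open>0 < R\<close> by (intro nn_integral_mono) (auto simp: indicator_def intro: ennreal_leI)
  also have "\<dots> \<le> ennreal C" by (rule bound)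
  finally have "R * measure (\<gamma> n) {z. R < dist z z0} \<le> C"
    using \<open>0 < R\<close> \<open>0 \<le> C\<close> by (simp add: emeasure_eq_measure ennreal_mult[symmetric])
  then have "measure (\<gamma> n) {z. R < dist z z0} \<le> C / R"
    using \<open>0 < R\<close> by (simp add: field_simps)
  also have "\<dots> = e * (C / (C + 1))"
    using assms by (simp add: R_def)
  also have "\<dots> \<le> e * 1"
    using assms by (intro mult_left_mono) auto
  finally show "measure (\<gamma> n) {z. (C + 1) / e < dist z z0} \<le> e"
    by (simp add: R_def)
qed

lemma compact_cball_prod:
  fixes x0 :: "'a::metric_space" and y0 :: "'b::metric_space"
  assumes "compact (cball x0 R)" "compact (cball y0 R)"
  shows "compact (cball (x0, y0) R)"
proof -
  have "cball (x0, y0) R \<subseteq> cball x0 R \<times> cball y0 R"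
  proof
    fix z assume "z \<in> cball (x0, y0) R"
    then show "z \<in> cball x0 R \<times> cball y0 R"
      using dist_fst_le[of "(x0, y0)" z] dist_snd_le[of "(x0, y0)" z] by (cases z) simp
  qed
  then have "cball (x0, y0) R = (cball x0 R \<times> cball y0 R) \<inter> cball (x0, y0) R" by blast
  then show ?thesis
    using compact_Int_closed[OF compact_Times[OF assms] closed_cball] by metis
qed

lemma compact_cball_if_proper:
  fixes x0 :: "'a::metric_space"
  assumes "\<And>(x0::'a) R. R > 0 \<Longrightarrow> compact (cball x0 R)"
  shows "compact (cball x0 R)"
  using assms by (cases R "0::real" rule: linorder_cases) auto

lemma nn_integral_coupling_fst:
  assumes "\<gamma> \<in> couplings \<mu> \<nu>" and [measurable]: "h \<in> borel_measurable borel"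
  shows "(\<integral>\<^sup>+z. h (fst z) \<partial>\<gamma>) = (\<integral>\<^sup>+x. h x \<partial>\<mu>)"
proof -
  have [measurable_cong]: "sets \<gamma> = sets borel"
    using couplingsD(1)[OF assms(1)] by (rule borel_probsD)
  show ?thesis
    unfolding couplingsD(2)[OF assms(1), symmetric] by (subst nn_integral_distr) auto
qed

lemma nn_integral_coupling_snd:
  assumes "\<gamma> \<in> couplings \<mu> \<nu>" and [measurable]: "h \<in> borel_measurable borel"
  shows "(\<integral>\<^sup>+z. h (snd z) \<partial>\<gamma>) = (\<integral>\<^sup>+x. h x \<partial>\<nu>)"
proof -
  have [measurable_cong]: "sets \<gamma> = sets borel"
    using couplingsD(1)[OF assms(1)] by (rule borel_probsD)
  show ?thesis
    unfolding couplingsD(3)[OF assms(1), symmetric] by (subst nn_integral_distr) auto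
qed

text \<open>Integrate the inequality \<open>dist x x0 powr p \<le> 2 powr p * (dist x y powr p + dist y x0 powr p)\<close> against the
coupling.\<close>
lemma coupling_moment_bound:
  fixes \<gamma> :: "('a::{metric_space, second_countable_topology} \<times> 'a) measure"
  assumes \<gamma>: "\<gamma> \<in> couplings \<mu> \<nu>" and "0 \<le> p"
  shows "(\<integral>\<^sup>+x. ennreal (dist x x0 powr p) \<partial>\<mu>)
    \<le> ennreal (2 powr p) * ((\<integral>\<^sup>+z. ennreal (dist (fst z) (snd z) powr p) \<partial>\<gamma>)
        + (\<integral>\<^sup>+y. ennreal (dist y x0 powr p) \<partial>\<nu>))"
proof -
  have [measurable_cong]: "sets \<gamma> = sets borel"
    using couplingsD(1)[OF \<gamma>] by (rule borel_probsD)
  have "(\<integral>\<^sup>+x. ennreal (dist x x0 powr p) \<partial>\<mu>) = (\<integral>\<^sup>+z. ennreal (dist (fst z) x0 powr p) \<partial>\<gamma>)"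
    by (rule nn_integral_coupling_fst[OF \<gamma>, symmetric]) measurable
  also have "\<dots> \<le> (\<integral>\<^sup>+z. ennreal (2 powr p) *
      (ennreal (dist (fst z) (snd z) powr p) + ennreal (dist (snd z) x0 powr p)) \<partial>\<gamma>)"
  proof (rule nn_integral_mono)
    fix z
    have "dist (fst z) x0 powr p \<le> (dist (fst z) (snd z) + dist (snd z) x0) powr p"
      using \<open>0 \<le> p\<close> by (intro powr_mono2 dist_triangle) auto
    also have "\<dots> \<le> 2 powr p * (dist (fst z) (snd z) powr p + dist (snd z) x0 powr p)"
      using \<open>0 \<le> p\<close> by (intro powr_add_le) auto
    finally show "ennreal (dist (fst z) x0 powr p)
        \<le> ennreal (2 powr p) * (ennreal (dist (fst z) (snd z) powr p) + ennreal (dist (snd z) x0 powr p))"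
      by (simp add: ennreal_plus[symmetric] ennreal_mult[symmetric] ennreal_leI del: ennreal_plus)
  qed
  also have "\<dots> = ennreal (2 powr p) * ((\<integral>\<^sup>+z. ennreal (dist (fst z) (snd z) powr p) \<partial>\<gamma>)
        + (\<integral>\<^sup>+z. ennreal (dist (snd z) x0 powr p) \<partial>\<gamma>))"
    by (subst nn_integral_cmult, measurable) (subst nn_integral_add, auto)
  also have "(\<integral>\<^sup>+z. ennreal (dist (snd z) x0 powr p) \<partial>\<gamma>) = (\<integral>\<^sup>+y. ennreal (dist y x0 powr p) \<partial>\<nu>)"
    by (rule nn_integral_coupling_snd[OF \<gamma>]) measurable
  finally show ?thesis .
qed

lemma finite_moment_all_centers:
  fixes \<nu> :: "'a::{metric_space, second_countable_topology} measure"
  assumes \<nu>: "\<nu> \<in> borel_probs" and "finite_moment p \<nu>" "0 \<le> p"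
  shows "(\<integral>\<^sup>+y. ennreal (dist y x0 powr p) \<partial>\<nu>) < \<infinity>"
proof -
  note N = borel_probsD[OF \<nu>]
  have [measurable_cong]: "sets \<nu> = sets borel" by (rule N)
  obtain x1 where x1: "(\<integral>\<^sup>+y. ennreal (dist y x1 powr p) \<partial>\<nu>) < \<infinity>"
    using assms(2) unfolding finite_moment_def by blast
  have "(\<integral>\<^sup>+y. ennreal (dist y x0 powr p) \<partial>\<nu>)
      \<le> (\<integral>\<^sup>+y. ennreal (2 powr p) * (ennreal (dist y x1 powr p) + ennreal (dist x1 x0 powr p)) \<partial>\<nu>)"
  proof (rule nn_integral_mono)
    fix y
    have "dist y x0 powr p \<le> (dist y x1 + dist x1 x0) powr p"
      using \<open>0 \<le> p\<close> by (intro powr_mono2 dist_triangle) auto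
    also have "\<dots> \<le> 2 powr p * (dist y x1 powr p + dist x1 x0 powr p)"
      using \<open>0 \<le> p\<close> by (intro powr_add_le) auto
    finally show "ennreal (dist y x0 powr p)
        \<le> ennreal (2 powr p) * (ennreal (dist y x1 powr p) + ennreal (dist x1 x0 powr p))"
      by (simp add: ennreal_plus[symmetric] ennreal_mult[symmetric] ennreal_leI del: ennreal_plus)
  qed
  also have "\<dots> = ennreal (2 powr p) * ((\<integral>\<^sup>+y. ennreal (dist y x1 powr p) \<partial>\<nu>) + ennreal (dist x1 x0 powr p))"
    by (subst nn_integral_cmult, measurable) (subst nn_integral_add, auto simp: N)
  also have "\<dots> < \<infinity>"
    using x1 by (simp add: ennreal_mult_less_top)
  finally show ?thesis .
qed

text \<open>The common bound comes from couplings of cost at most \<open>(r + 1) powr p\<close>, where \<open>r + 1\<close> could be any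
radius larger than \<open>r\<close>.\<close>
lemma wasserstein_ball_moment_bound:
  fixes \<nu> :: "'a::{metric_space, second_countable_topology} measure"
  assumes "\<nu> \<in> borel_probs" "finite_moment p \<nu>" "0 < p" "0 \<le> r"
  obtains C where "0 \<le> C"
    and "\<And>\<mu>. \<mu> \<in> wasserstein_ball p r \<nu> \<Longrightarrow> (\<integral>\<^sup>+x. ennreal (dist x x0 powr p) \<partial>\<mu>) \<le> ennreal C"
proof -
  let ?m = "\<integral>\<^sup>+y. ennreal (dist y x0 powr p) \<partial>\<nu>"
  obtain m where m: "?m = ennreal m" "0 \<le> m"
    using finite_moment_all_centers[OF assms(1,2), of x0] \<open>0 < p\<close> by (cases ?m) auto
  define C where "C = 2 powr p * ((r + 1) powr p + m)"
  have "(\<integral>\<^sup>+x. ennreal (dist x x0 powr p) \<partial>\<mu>) \<le> ennreal C" if \<mu>: "\<mu> \<in> wasserstein_ball p r \<nu>" for \<mu>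
  proof -
    have "wasserstein p \<mu> \<nu> \<le> ennreal r"
      using \<mu> by (simp add: wasserstein_ball_def)
    also have "\<dots> < ennreal (r + 1)"
      using \<open>0 \<le> r\<close> by (simp add: ennreal_less_iff)
    finally obtain \<gamma> where \<gamma>: "\<gamma> \<in> couplings \<mu> \<nu>"
        and cost: "(\<integral>\<^sup>+z. ennreal (dist (fst z) (snd z) powr p) \<partial>\<gamma>) \<le> ennreal ((r + 1) powr p)"
      using wasserstein_less_obtains[OF \<open>0 < p\<close>] by blast
    have "(\<integral>\<^sup>+x. ennreal (dist x x0 powr p) \<partial>\<mu>)
        \<le> ennreal (2 powr p) * ((\<integral>\<^sup>+z. ennreal (dist (fst z) (snd z) powr p) \<partial>\<gamma>) + ennreal m)"
      unfolding m(1)[symmetric] using \<open>0 < p\<close> by (intro coupling_moment_bound[OF \<gamma>]) auto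
    also have "\<dots> \<le> ennreal (2 powr p) * (ennreal ((r + 1) powr p) + ennreal m)"
      by (intro mult_left_mono add_right_mono cost) auto
    also have "\<dots> = ennreal C"
      using m by (simp add: C_def ennreal_plus[symmetric] ennreal_mult[symmetric] del: ennreal_plus)
    finally show ?thesis .
  qed
  moreover have "0 \<le> C"
    using m by (simp add: C_def)
  ultimately show thesis using that by blast
qed

text \<open>On the product space, the distance from \<open>(x0, x0)\<close> to \<open>(x, y)\<close> is at most
\<open>dist x y + 2 * dist y x0\<close>. The first summand is controlled by the cost and the second by the moment
of \<open>\<nu>\<close>, so the mean distances are bounded.\<close>
lemma near_optimal_couplings_tight:
  fixes \<nu> :: "'a::{metric_space, second_countable_topology} measure" and \<gamma> :: "nat \<Rightarrow> ('a \<times> 'a) measure"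
  assumes "1 \<le> p" and \<nu>: "\<nu> \<in> borel_probs" "finite_moment p \<nu>"
    and \<gamma>: "\<And>n. \<gamma> n \<in> couplings (\<mu> n) \<nu>"
    and cost: "\<And>n. (\<integral>\<^sup>+z. ennreal (dist (fst z) (snd z) powr p) \<partial>\<gamma> n) \<le> ennreal D" and "0 \<le> D" "0 < e"
  shows "\<exists>R. \<forall>n. measure (\<gamma> n) {z. R < dist z (x0, x0)} \<le> e"
proof -
  let ?m = "\<integral>\<^sup>+y. ennreal (dist y x0 powr p) \<partial>\<nu>"
  obtain m where m: "?m = ennreal m" "0 \<le> m"
    using finite_moment_all_centers[OF \<nu>, of x0] \<open>1 \<le> p\<close> by (cases ?m) auto
  have "(\<integral>\<^sup>+z. ennreal (dist z (x0, x0)) \<partial>\<gamma> n) \<le> ennreal (3 + D + 2 * m)" for n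
  proof -
    note G = borel_probsD[OF couplingsD(1)[OF \<gamma>[of n]]]
    have [measurable_cong]: "sets (\<gamma> n) = sets borel" by (rule G)
    have "(\<integral>\<^sup>+z. ennreal (dist z (x0, x0)) \<partial>\<gamma> n)
      \<le> (\<integral>\<^sup>+z. ennreal 3 + (ennreal (dist (fst z) (snd z) powr p) + ennreal 2 * ennreal (dist (snd z) x0 powr p)) \<partial>\<gamma> n)"
    proof (rule nn_integral_mono)
      fix z :: "'a \<times> 'a"
      obtain x y where z: "z = (x, y)" by fastforce
      have "dist z (x0, x0) \<le> dist x x0 + dist y x0"
        unfolding z dist_Pair_Pair by (rule sqrt_sum_squares_le_sum) auto
      also have "\<dots> \<le> dist x y + 2 * dist y x0"
        using dist_triangle[of x x0 y] by simp
      also have "\<dots> \<le> 3 + (dist x y powr p + 2 * dist y x0 powr p)"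
        using le_one_plus_powr[OF zero_le_dist \<open>1 \<le> p\<close>, of x y]
          le_one_plus_powr[OF zero_le_dist \<open>1 \<le> p\<close>, of y x0] by linarith
      finally have "ennreal (dist z (x0, x0)) \<le> ennreal (3 + (dist x y powr p + 2 * dist y x0 powr p))"
        by (rule ennreal_leI)
      also have "\<dots> = ennreal 3 + (ennreal (dist x y powr p) + ennreal 2 * ennreal (dist y x0 powr p))"
        by (subst ennreal_mult[symmetric] | subst ennreal_plus[symmetric] | simp del: ennreal_plus)+
      finally show "ennreal (dist z (x0, x0))
          \<le> ennreal 3 + (ennreal (dist (fst z) (snd z) powr p) + ennreal 2 * ennreal (dist (snd z) x0 powr p))"
        by (simp add: z)
    qed
    also have "\<dots> = ennreal 3 + ((\<integral>\<^sup>+z. ennreal (dist (fst z) (snd z) powr p) \<partial>\<gamma> n)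
        + ennreal 2 * (\<integral>\<^sup>+z. ennreal (dist (snd z) x0 powr p) \<partial>\<gamma> n))"
      by (simp add: nn_integral_add nn_integral_cmult G)
    also have "(\<integral>\<^sup>+z. ennreal (dist (snd z) x0 powr p) \<partial>\<gamma> n) = ennreal m"
      unfolding m(1)[symmetric] by (rule nn_integral_coupling_snd[OF \<gamma>]) measurable
    also have "ennreal 3 + ((\<integral>\<^sup>+z. ennreal (dist (fst z) (snd z) powr p) \<partial>\<gamma> n) + ennreal 2 * ennreal m)
        \<le> ennreal 3 + (ennreal D + ennreal 2 * ennreal m)"
      by (intro add_left_mono add_right_mono cost)
    also have "\<dots> = ennreal (3 + D + 2 * m)"
      using \<open>0 \<le> D\<close> m by (simp only: ennreal_mult[symmetric] ennreal_plus[symmetric]) simp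
    finally show ?thesis .
  qed
  moreover have "0 \<le> 3 + D + 2 * m"
    using \<open>0 \<le> D\<close> m by simp
  ultimately show ?thesis
    using bounded_mean_distance_imp_tight[of \<gamma> "(x0, x0)" "3 + D + 2 * m" e]
      couplingsD(1)[OF \<gamma>] \<open>0 < e\<close> by simp
qed

text \<open>Choose couplings of \<open>\<mu> n\<close> and \<open>\<nu>\<close> whose costs are optimal up to an error tending to zero, represent a
subsequence of them by almost surely convergent pairs, and take for \<open>\<mu>'\<close> the law of the first component
of the limit. Convergence of the measures is expressed by the Fatou inequality for nonnegative lower
semicontinuous integrands.\<close>
theorem wasserstein_ball_sequentially_compact:
  fixes \<nu> :: "'a::{complete_space, second_countable_topology} measure"
  assumes proper: "\<And>(x0::'a) R. R > 0 \<Longrightarrow> compact (cball x0 R)"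
    and p: "1 \<le> p" and r: "0 \<le> r"
    and \<nu>: "\<nu> \<in> borel_probs" "finite_moment p \<nu>"
    and ball: "\<And>n. \<mu> n \<in> wasserstein_ball p r \<nu>"
  obtains k :: "nat \<Rightarrow> nat" and \<mu>' where "strict_mono k" and "\<mu>' \<in> wasserstein_ball p r \<nu>"
    and "\<And>h. h \<in> borel_measurable borel \<Longrightarrow> seq_lower_semicontinuous h \<Longrightarrow>
        (\<integral>\<^sup>+x. h x \<partial>\<mu>') \<le> liminf (\<lambda>n. \<integral>\<^sup>+x. h x \<partial>\<mu> (k n))"
proof -
  let ?cost = "\<lambda>\<gamma>. \<integral>\<^sup>+z. ennreal (dist (fst z) (snd z) powr p) \<partial>\<gamma>"
  have "\<exists>\<gamma>. \<gamma> \<in> couplings (\<mu> n) \<nu> \<and> ?cost \<gamma> \<le> ennreal ((r + 1 / Suc n) powr p)" for n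
  proof -
    have "wasserstein p (\<mu> n) \<nu> \<le> ennreal r"
      using ball[of n] by (simp add: wasserstein_ball_def)
    also have "\<dots> < ennreal (r + 1 / Suc n)"
      using r by (simp add: ennreal_less_iff)
    finally show ?thesis
      using wasserstein_less_obtains[of p "\<mu> n" \<nu> "r + 1 / Suc n"] p by auto
  qed
  then obtain \<gamma> where \<gamma>: "\<And>n. \<gamma> n \<in> couplings (\<mu> n) \<nu>"
    and cost: "\<And>n. ?cost (\<gamma> n) \<le> ennreal ((r + 1 / Suc n) powr p)"
    by metis
  have cost_bound: "?cost (\<gamma> n) \<le> ennreal ((r + 1) powr p)" for n
    using cost[of n] p r by (elim order_trans) (intro ennreal_leI powr_mono2, auto)
  fix x0 :: 'a
  have compact: "compact (cball (x0, x0) R)" for R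
    using compact_cball_if_proper[OF proper] by (intro compact_cball_prod) auto
  have tight: "\<exists>R. \<forall>n. measure (\<gamma> n) {z. R < dist z (x0, x0)} \<le> e" if "0 < e" for e
    using near_optimal_couplings_tight[OF p \<nu> \<gamma> cost_bound _ that] by simp
  obtain k \<Omega> Z Z' where k: "strict_mono k" and \<Omega>: "prob_space (\<Omega> :: real measure)"
    and Z[measurable]: "\<And>n. Z n \<in> borel_measurable \<Omega>" and Z'[measurable]: "Z' \<in> borel_measurable \<Omega>"
    and law: "\<And>n. distr \<Omega> borel (Z n) = \<gamma> (k n)"
    and lim: "AE \<omega> in \<Omega>. (\<lambda>n. Z n \<omega>) \<longlonglongrightarrow> Z' \<omega>"
    by (rule tight_Skorohod_subsequence[OF compact couplingsD(1)[OF \<gamma>] tight]; (assumption | rule that))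
  define \<gamma>' where "\<gamma>' = distr \<Omega> borel Z'"
  define \<mu>' where "\<mu>' = distr \<gamma>' borel fst"
  have marginal: "distr \<Omega> borel (\<lambda>\<omega>. fst (Z n \<omega>)) = \<mu> (k n)"
    "distr \<Omega> borel (\<lambda>\<omega>. snd (Z n \<omega>)) = \<nu>" for n
  proof -
    have "distr \<Omega> borel (\<lambda>\<omega>. fst (Z n \<omega>)) = distr (\<gamma> (k n)) borel fst"
      "distr \<Omega> borel (\<lambda>\<omega>. snd (Z n \<omega>)) = distr (\<gamma> (k n)) borel snd"
      unfolding law[symmetric] by (subst distr_distr; simp add: comp_def borel_measurable_fst_snd)+
    then show "distr \<Omega> borel (\<lambda>\<omega>. fst (Z n \<omega>)) = \<mu> (k n)" "distr \<Omega> borel (\<lambda>\<omega>. snd (Z n \<omega>)) = \<nu>"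
      using couplingsD[OF \<gamma>] by auto
  qed
  have \<mu>'_law: "\<mu>' = distr \<Omega> borel (\<lambda>\<omega>. fst (Z' \<omega>))"
    unfolding \<mu>'_def \<gamma>'_def by (subst distr_distr) (auto simp: comp_def)
  have lim_fst: "AE \<omega> in \<Omega>. (\<lambda>n. fst (Z n \<omega>)) \<longlonglongrightarrow> fst (Z' \<omega>)"
    and lim_snd: "AE \<omega> in \<Omega>. (\<lambda>n. snd (Z n \<omega>)) \<longlonglongrightarrow> snd (Z' \<omega>)"
    using lim by (auto elim!: eventually_mono intro: tendsto_fst tendsto_snd)
  have "distr \<gamma>' borel snd = distr \<Omega> borel (\<lambda>\<omega>. snd (Z' \<omega>))"
    unfolding \<gamma>'_def by (subst distr_distr) (auto simp: comp_def)
  also have "\<dots> = \<nu>"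
    by (rule law_of_limit_eq_common_law[OF \<Omega> _ _ lim_snd marginal(2)]) measurable
  finally have coupling: "\<gamma>' \<in> couplings \<mu>' \<nu>"
    using borel_probs_distr[OF \<Omega> Z'] by (simp add: couplings_def \<mu>'_def \<gamma>'_def)
  have "?cost \<gamma>' \<le> liminf (\<lambda>n. ?cost (distr \<Omega> borel (Z n)))"
    unfolding \<gamma>'_def
  proof (rule Fatou_lower_semicontinuous[OF _ _ Z Z' lim])
    show "seq_lower_semicontinuous (\<lambda>z :: 'a \<times> 'a. ennreal (dist (fst z) (snd z) powr p))"
      unfolding seq_lower_semicontinuous_def
    proof (intro allI impI)
      fix X :: "nat \<Rightarrow> 'a \<times> 'a" and z assume "X \<longlonglongrightarrow> z"
      then have "(\<lambda>n. ennreal (dist (fst (X n)) (snd (X n)) powr p))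
          \<longlonglongrightarrow> ennreal (dist (fst z) (snd z) powr p)"
        using p by (intro tendsto_ennrealI tendsto_powr2 tendsto_intros) auto
      from lim_imp_Liminf[OF sequentially_bot this]
      show "ennreal (dist (fst z) (snd z) powr p)
          \<le> liminf (\<lambda>n. ennreal (dist (fst (X n)) (snd (X n)) powr p))"
        by simp
    qed
  qed measurable
  also have "\<dots> \<le> liminf (\<lambda>n. ennreal ((r + 1 / Suc (k n)) powr p))"
    unfolding law by (intro Liminf_mono always_eventually allI cost)
  also have "\<dots> = ennreal (r powr p)"
  proof -
    have "(\<lambda>n. 1 / Suc n) \<longlonglongrightarrow> (0::real)"
      using LIMSEQ_inverse_real_of_nat by (simp add: inverse_eq_divide)
    then have "(\<lambda>n. 1 / Suc (k n)) \<longlonglongrightarrow> (0::real)"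
      using LIMSEQ_subseq_LIMSEQ[OF _ k] by (fastforce simp: comp_def)
    then have "(\<lambda>n. (r + 1 / Suc (k n)) powr p) \<longlonglongrightarrow> (r + 0) powr p"
      using p r by (intro tendsto_powr2 tendsto_intros) auto
    then have "(\<lambda>n. ennreal ((r + 1 / Suc (k n)) powr p)) \<longlonglongrightarrow> ennreal (r powr p)"
      by (intro tendsto_ennrealI) simp
    then show ?thesis
      by (rule lim_imp_Liminf[OF sequentially_bot])
  qed
  finally have "wasserstein p \<mu>' \<nu> \<le> ennreal r"
    using coupling p r by (intro wasserstein_leI) auto
  moreover have "\<mu>' \<in> borel_probs"
    unfolding \<mu>'_law by (rule borel_probs_distr[OF \<Omega>]) measurable
  ultimately have "\<mu>' \<in> wasserstein_ball p r \<nu>"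
    by (simp add: wasserstein_ball_def)
  moreover have "(\<integral>\<^sup>+x. h x \<partial>\<mu>') \<le> liminf (\<lambda>n. \<integral>\<^sup>+x. h x \<partial>\<mu> (k n))"
    if "h \<in> borel_measurable borel" "seq_lower_semicontinuous h" for h
    unfolding \<mu>'_law marginal(1)[symmetric]
    by (rule Fatou_lower_semicontinuous[OF that _ _ lim_fst]) measurable
  ultimately show thesis
    using that k by blast
qed

section \<open>Upper semicontinuity of the objective\<close>

text \<open>Integrating the pointwise identity
\<open>(K + e * g - f) + max f 0 = (K + e * g) + max (- f) 0\<close>, in which all four terms are nonnegative, shows
that the extended integral of \<open>f\<close> equals \<open>K + e * G - H\<close> with \<open>G\<close> the integral of \<open>g\<close>. The positive part of
\<open>f\<close> is integrable, so this holds even if the value is \<open>-\<infinity>\<close>. The two claims follow from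
\<open>0 \<le> G \<le> C\<close>, which is used from above in the first and from below in the second.\<close>
lemma ext_integral_via_gap:
  fixes f g :: "'a::topological_space \<Rightarrow> real"
  assumes \<mu>: "\<mu> \<in> borel_probs"
    and [measurable]: "f \<in> borel_measurable borel" "g \<in> borel_measurable borel"
    and "0 \<le> K" "0 \<le> e" and g: "\<And>x. 0 \<le> g x" and f: "\<And>x. f x \<le> K + e * g x"
    and G: "(\<integral>\<^sup>+x. ennreal (g x) \<partial>\<mu>) \<le> ennreal C" and "0 \<le> C"
  defines "H \<equiv> (\<integral>\<^sup>+x. ennreal (K + e * g x - f x) \<partial>\<mu>)"
  shows "ereal a \<le> ext_integral \<mu> f \<Longrightarrow> H \<le> ennreal (K + e * C - a)"
    and "0 \<le> b \<Longrightarrow> H \<le> ennreal b \<Longrightarrow> ereal (K - b) \<le> ext_integral \<mu> f"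
proof -
  note M = borel_probsD[OF \<mu>]
  have [measurable_cong]: "sets \<mu> = sets borel" by (rule M)
  define P where "P = (\<integral>\<^sup>+x. ennreal (max (f x) 0) \<partial>\<mu>)"
  define N where "N = (\<integral>\<^sup>+x. ennreal (max (- f x) 0) \<partial>\<mu>)"
  define G where "G = (\<integral>\<^sup>+x. ennreal (g x) \<partial>\<mu>)"
  have ext: "ext_integral \<mu> f = enn2ereal P - enn2ereal N"
    by (simp add: ext_integral_def P_def N_def)
  obtain G' where G': "G = ennreal G'" "0 \<le> G'" "G' \<le> C"
    using G \<open>0 \<le> C\<close> unfolding G_def[symmetric] by (cases G) (auto simp: top_unique)
  have KG: "(\<integral>\<^sup>+x. ennreal (K + e * g x) \<partial>\<mu>) = ennreal (K + e * G')"
  proof -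
    have "(\<integral>\<^sup>+x. ennreal (K + e * g x) \<partial>\<mu>) = (\<integral>\<^sup>+x. ennreal K + ennreal e * ennreal (g x) \<partial>\<mu>)"
      using g \<open>0 \<le> K\<close> \<open>0 \<le> e\<close> by (simp add: ennreal_mult)
    also have "\<dots> = ennreal K + ennreal e * G"
      unfolding G_def by (simp add: nn_integral_add nn_integral_cmult M)
    finally show ?thesis
      using G' \<open>0 \<le> K\<close> \<open>0 \<le> e\<close> by (simp add: ennreal_mult)
  qed
  have "P \<le> ennreal (K + e * G')"
    unfolding KG[symmetric] P_def using f g \<open>0 \<le> K\<close> \<open>0 \<le> e\<close>
    by (intro nn_integral_mono ennreal_leI) (auto simp: max_def)
  then obtain P' where P': "P = ennreal P'" "0 \<le> P'"
    by (cases P) (auto simp: top_unique)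
  have "H + P = (\<integral>\<^sup>+x. ennreal (K + e * g x - f x) + ennreal (max (f x) 0) \<partial>\<mu>)"
    unfolding H_def P_def by (rule nn_integral_add[symmetric]) measurable
  also have "\<dots> = (\<integral>\<^sup>+x. ennreal (K + e * g x) + ennreal (max (- f x) 0) \<partial>\<mu>)"
  proof (rule nn_integral_cong)
    fix x
    have "ennreal (K + e * g x - f x) + ennreal (max (f x) 0) = ennreal (K + e * g x - f x + max (f x) 0)"
      using f[of x] by (intro ennreal_plus[symmetric]) auto
    also have "\<dots> = ennreal (K + e * g x + max (- f x) 0)"
      by (simp add: max_def)
    also have "\<dots> = ennreal (K + e * g x) + ennreal (max (- f x) 0)"
      using g[of x] \<open>0 \<le> K\<close> \<open>0 \<le> e\<close> by (intro ennreal_plus) auto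
    finally show "ennreal (K + e * g x - f x) + ennreal (max (f x) 0)
        = ennreal (K + e * g x) + ennreal (max (- f x) 0)" .
  qed
  also have "\<dots> = ennreal (K + e * G') + N"
    unfolding KG[symmetric] N_def by (rule nn_integral_add) measurable
  finally have balance: "H + ennreal P' = ennreal (K + e * G') + N"
    using P' by simp
  have KG_nonneg: "0 \<le> K + e * G'" and KG_le: "K + e * G' \<le> K + e * C"
    using G' \<open>0 \<le> K\<close> \<open>0 \<le> e\<close> by (auto intro: mult_left_mono)
  have finite_balance: "H' + P' = K + e * G' + N'"
    if "H = ennreal H'" "N = ennreal N'" "0 \<le> H'" "0 \<le> N'" for H' N'
    using balance that P' KG_nonneg by (simp add: ennreal_plus[symmetric] del: ennreal_plus)
  show "H \<le> ennreal (K + e * C - a)" if a: "ereal a \<le> ext_integral \<mu> f"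
  proof -
    obtain N' where N': "N = ennreal N'" "0 \<le> N'"
      using a P' unfolding ext by (cases N) auto
    have "H + ennreal P' \<noteq> \<infinity>"
      unfolding balance N'(1) by (simp add: ennreal_add_eq_top)
    then have "H \<noteq> \<infinity>"
      by auto
    then obtain H' where H': "H = ennreal H'" "0 \<le> H'"
      by (cases H) auto
    have "a \<le> P' - N'"
      using a N' P' unfolding ext by simp
    then have "H' \<le> K + e * C - a"
      using finite_balance[OF H'(1) N'(1) H'(2) N'(2)] KG_le by linarith
    then show ?thesis
      using H' by (simp add: ennreal_leI)
  qed
  show "ereal (K - b) \<le> ext_integral \<mu> f" if b: "0 \<le> b" "H \<le> ennreal b"
  proof -
    obtain H' where H': "H = ennreal H'" "0 \<le> H'" "H' \<le> b"
      using b by (cases H) (auto simp: top_unique)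
    have "ennreal (K + e * G') + N \<noteq> \<infinity>"
      unfolding balance[symmetric] H'(1) by (simp add: ennreal_add_eq_top)
    then have "N \<noteq> \<infinity>"
      by auto
    then obtain N' where N': "N = ennreal N'" "0 \<le> N'"
      by (cases N) auto
    have "K - b \<le> P' - N'"
      using finite_balance[OF H'(1) N'(1) H'(2) N'(2)] H' KG_nonneg G' \<open>0 \<le> e\<close>
        mult_nonneg_nonneg[OF \<open>0 \<le> e\<close> G'(2)] by linarith
    then show ?thesis
      using N' P' unfolding ext by simp
  qed
qed

lemma gap_lower_semicontinuous:
  fixes f g :: "'a::topological_space \<Rightarrow> real"
  assumes usc: "upper_semicontinuous f" and g: "continuous_on UNIV g"
  shows "seq_lower_semicontinuous (\<lambda>x. ennreal (g x - f x))"
  unfolding seq_lower_semicontinuous_def le_Liminf_iff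
proof (intro allI impI)
  fix X z y
  assume lim: "X \<longlonglongrightarrow> z" and y: "y < ennreal (g z - f z)"
  then obtain u where u: "y = ennreal u" "0 \<le> u"
    by (cases y) auto
  then have "u < g z - f z"
    using y by (simp add: ennreal_less_iff)
  define \<delta> where "\<delta> = (g z - f z - u) / 2"
  have "0 < \<delta>"
    using \<open>u < g z - f z\<close> by (simp add: \<delta>_def)
  have "\<forall>\<^sub>F x in nhds z. f x < f z + \<delta>"
    using usc \<open>0 < \<delta>\<close> by (simp add: upper_semicontinuous_def)
  then have "\<forall>\<^sub>F n in sequentially. f (X n) < f z + \<delta>"
    using lim unfolding filterlim_iff by blast
  moreover have "(\<lambda>n. g (X n)) \<longlonglongrightarrow> g z"
    using continuous_on_tendsto_compose[OF g lim] by simp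
  then have "\<forall>\<^sub>F n in sequentially. g z - \<delta> < g (X n)"
    using \<open>0 < \<delta>\<close> by (intro order_tendstoD) auto
  ultimately show "\<forall>\<^sub>F n in sequentially. y < ennreal (g (X n) - f (X n))"
  proof eventually_elim
    case (elim n)
    moreover have "2 * \<delta> = g z - f z - u"
      by (simp add: \<delta>_def)
    ultimately have "u < g (X n) - f (X n)"
      by linarith
    then show ?case
      using u by (simp add: ennreal_less_iff)
  qed
qed

section \<open>Existence of a maximizer\<close>

text \<open>A maximizing sequence in the ball has a subsequence with a limit \<open>\<mu>'\<close> in the ball. Every real \<open>a\<close> below
the supremum \<open>S\<close> is eventually exceeded by the objective along the sequence. This bounds the gap
integrals from above, Fatou's lemma transfers the bound to \<open>\<mu>'\<close>, and the resulting estimate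
\<open>a - e * C\<close> for the objective at \<open>\<mu>'\<close> holds for every \<open>e > 0\<close>.\<close>
theorem theorem3:
  fixes \<nu> :: "'a::polish_space measure"
    and f :: "'a \<Rightarrow> real"
    and p r :: real
  assumes proper: "\<And>(x0::'a) R. R > 0 \<Longrightarrow> compact (cball x0 R)"
    and p: "1 \<le> p"
    and r: "0 < r"
    and nu: "\<nu> \<in> borel_probs"
    and moment: "finite_moment p \<nu>"
    and usc: "upper_semicontinuous f"
    and well_defined: "\<And>\<mu>. \<mu> \<in> wasserstein_ball p r \<nu> \<Longrightarrow>
          (\<integral>\<^sup>+x. ennreal (max (f x) 0) \<partial>\<mu>) < \<infinity> \<or> (\<integral>\<^sup>+x. ennreal (max (- f x) 0) \<partial>\<mu>) < \<infinity>"
    and growth: "\<exists>x0 c p'. 0 < c \<and> 0 < p' \<and> p' < p \<and> (\<forall>x. f x \<le> c * (1 + dist x x0 powr p'))"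
  shows "\<exists>\<mu>\<^sub>0 \<in> wasserstein_ball p r \<nu>.
           ext_integral \<mu>\<^sub>0 f = (SUP \<mu>\<in>wasserstein_ball p r \<nu>. ext_integral \<mu> f)"
proof -
  let ?B = "wasserstein_ball p r \<nu>"
  define S where "S = (SUP \<mu>\<in>?B. ext_integral \<mu> f)"
  obtain x0 c p' where c: "0 < c" and p': "0 < p'" "p' < p"
    and growth_bound: "\<And>x. f x \<le> c * (1 + dist x x0 powr p')"
    using growth by blast
  have f_meas: "f \<in> borel_measurable borel"
    using usc by (rule upper_semicontinuous_borel_measurable)
  have g_cont: "continuous_on UNIV (\<lambda>x. dist x x0 powr p)"
    using p by (intro continuous_on_powr' continuous_intros) auto
  then have g_meas: "(\<lambda>x. dist x x0 powr p) \<in> borel_measurable borel"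
    by (rule borel_measurable_continuous_onI)
  have "\<nu> \<in> ?B"
    using wasserstein_ball_center[OF nu, of p r] p r by simp
  obtain C where C: "0 \<le> C"
    and moments: "\<And>\<mu>. \<mu> \<in> ?B \<Longrightarrow> (\<integral>\<^sup>+x. ennreal (dist x x0 powr p) \<partial>\<mu>) \<le> ennreal C"
    using wasserstein_ball_moment_bound[OF nu moment, of r x0] p r by auto

  obtain v where v: "incseq v" "range v \<subseteq> (\<lambda>\<mu>. ext_integral \<mu> f) ` ?B" "S = (SUP n. v n)"
    using Sup_countable_SUP[of "(\<lambda>\<mu>. ext_integral \<mu> f) ` ?B"] \<open>\<nu> \<in> ?B\<close> unfolding S_def by blast
  have "\<exists>\<mu>. \<mu> \<in> ?B \<and> v n = ext_integral \<mu> f" for n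
    using v(2) by blast
  then obtain \<mu> where \<mu>: "\<And>n. \<mu> n \<in> ?B" and v_eq: "\<And>n. v n = ext_integral (\<mu> n) f"
    by metis
  have ext_lim: "(\<lambda>n. ext_integral (\<mu> n) f) \<longlonglongrightarrow> S"
    unfolding v_eq[symmetric] v(3) by (rule LIMSEQ_SUP[OF v(1)])
  obtain k \<mu>' where k: "strict_mono k" and \<mu>': "\<mu>' \<in> ?B"
    and Fatou: "\<And>h. h \<in> borel_measurable borel \<Longrightarrow> seq_lower_semicontinuous h \<Longrightarrow>
        (\<integral>\<^sup>+x. h x \<partial>\<mu>') \<le> liminf (\<lambda>n. \<integral>\<^sup>+x. h x \<partial>\<mu> (k n))"
    using wasserstein_ball_sequentially_compact[where \<mu> = \<mu>,
        OF proper p less_imp_le[OF r] nu moment \<mu>] by blast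

  have approx: "ereal (a - e * C) \<le> ext_integral \<mu>' f" if a: "ereal a < S" and e: "0 < e" for a e
  proof -
    obtain K0 where K0: "0 \<le> K0" "\<And>t. 0 \<le> t \<Longrightarrow> t powr p' \<le> K0 + e / c * t powr p"
      using powr_le_const_plus_eps_powr[OF p', of "e / c"] e c by auto
    \<comment> \<open>The summand \<open>\<bar>a\<bar>\<close> only serves to make the bound \<open>K + e * C - a\<close> on the gap integrals nonnegative.\<close>
    define K where "K = c * (1 + K0) + \<bar>a\<bar>"
    have "0 \<le> K"
      using K0 c by (simp add: K_def)
    have f_le: "f x \<le> K + e * dist x x0 powr p" for x
    proof -
      have "f x \<le> c * (1 + (K0 + e / c * dist x x0 powr p))"
        using growth_bound[of x] K0(2)[of "dist x x0"] c
        by (elim order_trans) (intro mult_left_mono, auto)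
      also have "\<dots> = c * (1 + K0) + e * dist x x0 powr p"
        using c by (simp add: field_simps)
      finally show ?thesis by (simp add: K_def)
    qed
    define H where "H \<mu> = (\<integral>\<^sup>+x. ennreal (K + e * dist x x0 powr p - f x) \<partial>\<mu>)" for \<mu>
    have gap: "ereal a \<le> ext_integral \<mu> f \<Longrightarrow> H \<mu> \<le> ennreal (K + e * C - a)"
      "0 \<le> b \<Longrightarrow> H \<mu> \<le> ennreal b \<Longrightarrow> ereal (K - b) \<le> ext_integral \<mu> f" if "\<mu> \<in> ?B" for \<mu> b
      unfolding H_def
      using ext_integral_via_gap[OF _ f_meas g_meas \<open>0 \<le> K\<close> less_imp_le[OF e] _ f_le moments[OF that] C]
        that by (auto simp: wasserstein_ball_def)
    have "H \<mu>' \<le> liminf (\<lambda>n. H (\<mu> (k n)))"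
      unfolding H_def
    proof (rule Fatou)
      show "(\<lambda>x. ennreal (K + e * dist x x0 powr p - f x)) \<in> borel_measurable borel"
        using f_meas g_meas by measurable
      show "seq_lower_semicontinuous (\<lambda>x. ennreal (K + e * dist x x0 powr p - f x))"
        by (intro gap_lower_semicontinuous[OF usc] continuous_intros g_cont)
    qed
    also have "\<dots> \<le> ennreal (K + e * C - a)"
    proof (rule liminf_le_bound)
      have "\<forall>\<^sub>F n in sequentially. ereal a < ext_integral (\<mu> (k n)) f"
        using order_tendstoD(1)[OF LIMSEQ_subseq_LIMSEQ[OF ext_lim k] a] by (simp add: comp_def)
      then show "\<forall>\<^sub>F n in sequentially. H (\<mu> (k n)) \<le> ennreal (K + e * C - a)"
        by eventually_elim (intro gap(1)[OF \<mu>] less_imp_le)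
    qed
    finally have "H \<mu>' \<le> ennreal (K + e * C - a)" .
    moreover have "0 \<le> K + e * C - a"
    proof -
      have "0 \<le> c * (1 + K0)" "0 \<le> e * C"
        using K0 c e C by simp_all
      then show ?thesis
        unfolding K_def by linarith
    qed
    ultimately have "ereal (K - (K + e * C - a)) \<le> ext_integral \<mu>' f"
      by (intro gap(2)[OF \<mu>'])
    then show ?thesis by simp
  qed
  have "S \<le> ext_integral \<mu>' f"
  proof (rule ccontr)
    assume "\<not> S \<le> ext_integral \<mu>' f"
    then have "ext_integral \<mu>' f < S" by (simp only: not_le)
    then obtain a where a: "ext_integral \<mu>' f < ereal a" "ereal a < S"
      using ereal_dense2 by blast
    have "ereal a \<le> ext_integral \<mu>' f"
    proof (rule ereal_le_epsilon2)
      fix d :: real assume "0 < d"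
      have "d / (C + 1) * C \<le> d"
        using C \<open>0 < d\<close> by (simp add: field_simps)
      moreover have "ereal (a - d / (C + 1) * C) \<le> ext_integral \<mu>' f"
        using approx[OF a(2), of "d / (C + 1)"] \<open>0 < d\<close> C by simp
      ultimately show "ereal a \<le> ext_integral \<mu>' f + ereal d"
        by (cases "ext_integral \<mu>' f") auto
    qed
    then show False using a(1) by simp
  qed
  then have "ext_integral \<mu>' f = S"
    unfolding S_def by (intro antisym SUP_upper \<mu>') (simp add: S_def)
  then show ?thesis
    using \<mu>' unfolding S_def by blast
qed

end
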